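(* Let $k\ge 3$ be an odd integer and let $(G,\sigma)$ be a signed graph with a nowhere-zero $\mathbb{Z}_k$-flow $(\tau,f_1)$. If $(G,\sigma)$ does not contain a long barbell, then there is a nowhere-zero $k$-flow $(\tau,f_2)$ of $(G,\sigma)$ such that $f_1(e)\equiv f_2(e)\pmod k$ for every edge $e$.
   Context: A signed graph $(G,\sigma)$ is a graph $G$ with a signature $\sigma:E(G)\to\{-1,+1\}$; edges with $\sigma(e)=-1$ are negative. A circuit is balanced if it contains an even number of negative edges and unbalanced otherwise. A long barbell is the union of two vertex-disjoint unbalanced circuits together with a path meeting the circuits only at its two ends. Each edge $e=uv$ consists of half-edges $h_e^u$ and $h_e^v$; $H(v)$ is the set of half-edges at $v$. An orientation is a map $\tau$ from half-edges to $\{\pm1\}$ with $\tau(h_e^u)\tau(h_e^v)=-\sigma(e)$ for each edge $e=uv$. For $f$ on $E(G)$, $\partial(\tau,f)(v)=\sum_{h\in H(v)}\tau(h)f(e_h)$ with $e_h$ the edge containing $h$. A nowhere-zero $k$-flow $(\tau,f)$: $f:E(G)\to\mathbb{Z}$, $1\le|f(e)|\le k-1$ for all $e$, and $\partial(\tau,f)(v)=0$ for all $v$. A nowhere-zero $\mathbb{Z}_k$-flow $(\tau,f)$: $f:E(G)\to\mathbb{Z}_k\setminus\{0\}$ with $\partial(\tau,f)(v)\equiv0\pmod k$ for all $v$. *)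

theory Defs
  imports "HOL-Number_Theory.Residues"
begin

text \<open>
  Graphs are finite; loops and parallel edges are allowed. An edge \<open>e\<close> consists of the two
  half-edges \<open>(e, False)\<close> and \<open>(e, True)\<close>, and \<open>endpoint G (e, b)\<close> is the vertex at which
  \<open>(e, b)\<close> is attached. In this way a loop has two distinct half-edges at its vertex. Which of the
  two half-edges carries the label \<open>False\<close> is immaterial: the edges are undirected.
\<close>

type_synonym 'e half_edge = "'e \<times> bool"

record ('v, 'e) multigraph =
  verts :: "'v set"
  edges :: "'e set"
  endpoint :: "'e half_edge \<Rightarrow> 'v"

definition finite_graph :: "('v, 'e) multigraph \<Rightarrow> bool" where
  "finite_graph G \<longleftrightarrow> finite (verts G) \<and> finite (edges G)
     \<and> (\<forall>e\<in>edges G. \<forall>b. endpoint G (e, b) \<in> verts G)"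

definition signature :: "('v, 'e) multigraph \<Rightarrow> ('e \<Rightarrow> int) \<Rightarrow> bool" where
  "signature G \<sigma> \<longleftrightarrow> (\<forall>e\<in>edges G. \<sigma> e \<in> {-1, 1})"

definition half_edges_at :: "('v, 'e) multigraph \<Rightarrow> 'v \<Rightarrow> 'e half_edge set" where
  "half_edges_at G v = {h. fst h \<in> edges G \<and> endpoint G h = v}"

definition joins :: "('v, 'e) multigraph \<Rightarrow> 'e \<Rightarrow> 'v \<Rightarrow> 'v \<Rightarrow> bool" where
  "joins G e u v \<longleftrightarrow> e \<in> edges G \<and> (\<exists>b. endpoint G (e, b) = u \<and> endpoint G (e, \<not> b) = v)"

text \<open>
  A circuit or path is given by the list of its vertices and the list of its edges in order of
  traversal. A loop is a circuit of length 1, and two parallel edges form a circuit of length 2;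
  only in the latter case does \<open>distinct es\<close> not already follow from \<open>distinct vs\<close>.
\<close>

definition circuit :: "('v, 'e) multigraph \<Rightarrow> 'v list \<Rightarrow> 'e list \<Rightarrow> bool" where
  "circuit G vs es \<longleftrightarrow> vs \<noteq> [] \<and> length es = length vs \<and> distinct vs \<and> distinct es
     \<and> (\<forall>i<length vs. joins G (es ! i) (vs ! i) (vs ! (Suc i mod length vs)))"

definition path :: "('v, 'e) multigraph \<Rightarrow> 'v list \<Rightarrow> 'e list \<Rightarrow> bool" where
  "path G vs es \<longleftrightarrow> length vs = Suc (length es) \<and> distinct vs \<and> set vs \<subseteq> verts G
     \<and> (\<forall>i<length es. joins G (es ! i) (vs ! i) (vs ! Suc i))"

definition balanced :: "('e \<Rightarrow> int) \<Rightarrow> 'e list \<Rightarrow> bool" where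
  "balanced \<sigma> es \<longleftrightarrow> even (card {e \<in> set es. \<sigma> e = -1})"

definition long_barbell ::
  "('v, 'e) multigraph \<Rightarrow> ('e \<Rightarrow> int) \<Rightarrow> 'v list \<Rightarrow> 'e list \<Rightarrow> 'v list \<Rightarrow> 'e list
     \<Rightarrow> 'v list \<Rightarrow> 'e list \<Rightarrow> bool" where
  "long_barbell G \<sigma> us cs vs ds ps qs \<longleftrightarrow>
     circuit G us cs \<and> \<not> balanced \<sigma> cs \<and> circuit G vs ds \<and> \<not> balanced \<sigma> ds
     \<and> set us \<inter> set vs = {}
     \<and> path G ps qs \<and> set ps \<inter> set us = {hd ps} \<and> set ps \<inter> set vs = {last ps}"

definition contains_long_barbell :: "('v, 'e) multigraph \<Rightarrow> ('e \<Rightarrow> int) \<Rightarrow> bool" where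
  "contains_long_barbell G \<sigma> \<longleftrightarrow> (\<exists>us cs vs ds ps qs. long_barbell G \<sigma> us cs vs ds ps qs)"

definition orientation :: "('v, 'e) multigraph \<Rightarrow> ('e \<Rightarrow> int) \<Rightarrow> ('e half_edge \<Rightarrow> int) \<Rightarrow> bool" where
  "orientation G \<sigma> \<tau> \<longleftrightarrow>
     (\<forall>e\<in>edges G. (\<forall>b. \<tau> (e, b) \<in> {-1, 1}) \<and> \<tau> (e, False) * \<tau> (e, True) = - \<sigma> e)"

definition boundary ::
  "('v, 'e) multigraph \<Rightarrow> ('e half_edge \<Rightarrow> int) \<Rightarrow> ('e \<Rightarrow> int) \<Rightarrow> 'v \<Rightarrow> int" where
  "boundary G \<tau> f v = (\<Sum>h\<in>half_edges_at G v. \<tau> h * f (fst h))"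

definition nowhere_zero_flow ::
  "('v, 'e) multigraph \<Rightarrow> ('e \<Rightarrow> int) \<Rightarrow> int \<Rightarrow> ('e half_edge \<Rightarrow> int) \<Rightarrow> ('e \<Rightarrow> int) \<Rightarrow> bool" where
  "nowhere_zero_flow G \<sigma> k \<tau> f \<longleftrightarrow> orientation G \<sigma> \<tau>
     \<and> (\<forall>e\<in>edges G. 1 \<le> \<bar>f e\<bar> \<and> \<bar>f e\<bar> \<le> k - 1)
     \<and> (\<forall>v\<in>verts G. boundary G \<tau> f v = 0)"

text \<open>
  \<open>residue_ring k\<close> represents the integers modulo \<open>k\<close> on the carrier \<open>{0..k - 1}\<close>, so the
  boundary of a \<open>\<int>\<^sub>k\<close>-valued function is taken over these integer representatives and then
  considered modulo \<open>k\<close>.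
\<close>

definition nowhere_zero_mod_flow ::
  "('v, 'e) multigraph \<Rightarrow> ('e \<Rightarrow> int) \<Rightarrow> int \<Rightarrow> ('e half_edge \<Rightarrow> int) \<Rightarrow> ('e \<Rightarrow> int) \<Rightarrow> bool" where
  "nowhere_zero_mod_flow G \<sigma> k \<tau> f \<longleftrightarrow> orientation G \<sigma> \<tau>
     \<and> (\<forall>e\<in>edges G. f e \<in> carrier (residue_ring k) - {0})
     \<and> (\<forall>v\<in>verts G. [boundary G \<tau> f v = 0] (mod k))"

end

theory Submission
  imports Defs
begin

text \<open>
  The boundary of \<open>x = f\<^sub>1 / k\<close> is integral, and it suffices to find a vector \<open>y\<close> with entries
  \<open>0\<close> and \<open>1\<close> and the same boundary, since then \<open>f\<^sub>2 = f\<^sub>1 - k y\<close> is the required flow. Among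
  the vectors in \<open>[0, 1]\<^sup>E\<close> with this boundary choose \<open>y\<close> with as few fractional entries as
  possible. No nonzero vector with boundary \<open>0\<close> is supported on the set \<open>F\<close> of fractional edges,
  so \<open>F\<close> has at most as many edges as vertices; as integrality excludes vertices of degree 1,
  \<open>F\<close> is a disjoint union of circuits. These are unbalanced, and \<open>y\<close> equals \<open>1/2\<close> on them.
  As \<open>k\<close> is odd, the boundary of \<open>y\<close> has even sum over each component of \<open>G\<close>, so each
  component contains an even number of them; two of them would yield a long barbell.
\<close>

section \<open>Linear systems, walks and cyclic sums\<close>

text \<open>Gaussian elimination, one equation at a time: an equation with only zero coefficients is
  dropped, any other serves to eliminate one unknown. Either way the unknowns keep outnumbering the
  equations.\<close>

lemma homogeneous_system_nontrivial:
  fixes A :: "'v \<Rightarrow> 'e \<Rightarrow> real"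
  assumes "finite V" "finite E" "card V < card E"
  shows "\<exists>z. (\<exists>e\<in>E. z e \<noteq> 0) \<and> (\<forall>e. e \<notin> E \<longrightarrow> z e = 0) \<and> (\<forall>v\<in>V. (\<Sum>e\<in>E. A v e * z e) = 0)"
  using assms
proof (induction V arbitrary: E A rule: finite_induct)
  case empty
  then obtain e where "e \<in> E" by fastforce
  then show ?case by (intro exI[of _ "\<lambda>e'. of_bool (e' = e)"]) auto
next
  case (insert v V)
  show ?case
  proof (cases "\<forall>e\<in>E. A v e = 0")
    case True
    from insert.prems insert.hyps have "card V < card E" by simp
    from insert.IH[OF insert.prems(1) this, of A] True show ?thesis by auto
  next
    case False
    then obtain d where d: "d \<in> E" "A v d \<noteq> 0" by blast
    define E' where "E' = E - {d}"
    have E': "finite E'" "card V < card E'" "d \<notin> E'" "E = insert d E'"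
      using insert.prems insert.hyps d by (auto simp: E'_def card_Diff_singleton)
    obtain z where z: "\<exists>e\<in>E'. z e \<noteq> 0" "\<forall>e. e \<notin> E' \<longrightarrow> z e = 0"
      "\<forall>w\<in>V. (\<Sum>e\<in>E'. (A w e - A w d * A v e / A v d) * z e) = 0"
      using insert.IH[OF E'(1,2), of "\<lambda>w e. A w e - A w d * A v e / A v d"] by blast
    define s where "s = (\<Sum>e\<in>E'. A v e * z e)"
    \<comment> \<open>The value at the pivot \<open>d\<close> is the one forced by equation
      \<open>v\<close>.\<close>
    define y where "y = z(d := - s / A v d)"
    have y: "(\<Sum>e\<in>E. A w e * y e) = (\<Sum>e\<in>E'. A w e * z e) - A w d * s / A v d" for w
    proof -
      have "(\<Sum>e\<in>E'. A w e * y e) = (\<Sum>e\<in>E'. A w e * z e)"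
        using E'(3) by (intro sum.cong) (auto simp: y_def)
      then show ?thesis using E' by (simp add: y_def)
    qed
    have "(\<Sum>e\<in>E. A w e * y e) = 0" if "w \<in> insert v V" for w
    proof (cases "w = v")
      case True
      then show ?thesis using d by (simp add: y s_def)
    next
      case False
      then have "(\<Sum>e\<in>E'. (A w e - A w d * A v e / A v d) * z e) = 0" using z(3) that by auto
      moreover have "(\<Sum>e\<in>E'. (A w e - A w d * A v e / A v d) * z e)
          = (\<Sum>e\<in>E'. A w e * z e) - A w d * s / A v d"
        by (simp add: s_def left_diff_distrib sum_subtractf sum_distrib_left sum_divide_distrib
            mult.assoc)
      ultimately show ?thesis by (simp add: y)
    qed
    moreover have "\<exists>e\<in>E. y e \<noteq> 0" using z(1) E' by (auto simp: y_def)
    moreover have "\<forall>e. e \<notin> E \<longrightarrow> y e = 0" using z(2) E'(4) by (auto simp: y_def)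
    ultimately show ?thesis by blast
  qed
qed

text \<open>The length is minimal over all pairs of ends in \<open>A\<close> and \<open>B\<close>; a
  repeated vertex or an inner visit to \<open>A\<close> or \<open>B\<close> would give a shorter
  walk.\<close>

lemma shortest_walk:
  assumes "(a, b) \<in> R\<^sup>*" "a \<in> A" "b \<in> B"
  obtains p :: "nat \<Rightarrow> 'a" and n where "p 0 \<in> A" "p n \<in> B" "\<And>i. i < n \<Longrightarrow> (p i, p (Suc i)) \<in> R"
    "inj_on p {..n}" "\<And>i. i \<le> n \<Longrightarrow> p i \<in> A \<Longrightarrow> i = 0" "\<And>i. i \<le> n \<Longrightarrow> p i \<in> B \<Longrightarrow> i = n"
proof -
  define P where "P n \<longleftrightarrow> (\<exists>a\<in>A. \<exists>b\<in>B. (a, b) \<in> R ^^ n)" for n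
  have "\<exists>n. P n" using assms by (auto simp: P_def dest!: rtrancl_imp_relpow)
  then obtain n where n: "P n" "\<And>m. m < n \<Longrightarrow> \<not> P m"
    using exists_least_iff[of P] by blast
  from n(1) obtain p where p: "p 0 \<in> A" "p n \<in> B" "\<And>i. i < n \<Longrightarrow> (p i, p (Suc i)) \<in> R"
    by (auto simp: P_def relpow_fun_conv)
  have seg: "(p i, p j) \<in> R ^^ (j - i)" if "i \<le> j" "j \<le> n" for i j
    unfolding relpow_fun_conv using p(3) that by (intro exI[of _ "\<lambda>m. p (i + m)"]) auto
  have "p i \<noteq> p j" if "i < j" "j \<le> n" for i j
  proof
    assume eq: "p i = p j"
    \<comment> \<open>Cutting out the closed part between \<open>i\<close> and \<open>j\<close>
      leaves fewer than \<open>n\<close> steps.\<close>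
    have "(p 0, p n) \<in> R ^^ (i + (n - j))"
      unfolding relpow_add using seg[of 0 i] seg[of j n] that eq by (intro relcompI[of _ "p j"]) auto
    then have "P (i + (n - j))" using p by (auto simp: P_def)
    with n(2)[of "i + (n - j)"] that show False by auto
  qed
  then have "inj_on p {..n}" by (metis atMost_iff inj_onI linorder_neqE_nat)
  moreover have "i = 0" if "i \<le> n" "p i \<in> A" for i
    using seg[of i n] that p(2) n(2)[of "n - i"] by (cases i) (auto simp: P_def)
  moreover have "i = n" if "i \<le> n" "p i \<in> B" for i
    using seg[of 0 i] that p(1) n(2)[of i] unfolding P_def by (cases "i < n") auto
  ultimately show thesis using that p by blast
qed

lemma sum_cyclic_shift:
  fixes g :: "nat \<Rightarrow> real"
  shows "(\<Sum>i<n. g (Suc i mod n)) = (\<Sum>i<n. g i)"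
proof (cases n)
  case (Suc m)
  have "(\<Sum>i<m. g (Suc i mod Suc m)) = (\<Sum>i<m. g (Suc i))" by (intro sum.cong) auto
  with Suc show ?thesis using sum.lessThan_Suc_shift[of g m] by simp
qed simp

section \<open>The real boundary operator\<close>

locale oriented_signed_graph =
  fixes G :: "('v, 'e) multigraph" and \<sigma> :: "'e \<Rightarrow> int" and \<tau> :: "'e half_edge \<Rightarrow> int"
  assumes finite_graph: "finite_graph G" and signature: "signature G \<sigma>"
    and orientation: "orientation G \<sigma> \<tau>"
begin

lemma finite_edges: "finite (edges G)" and finite_verts: "finite (verts G)"
  and endpoint_verts: "e \<in> edges G \<Longrightarrow> endpoint G (e, b) \<in> verts G"
  using finite_graph by (auto simp: finite_graph_def)

lemma joins_verts: "joins G e u v \<Longrightarrow> u \<in> verts G \<and> v \<in> verts G"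
  using endpoint_verts unfolding joins_def by metis

lemma half_edges_at_verts: "h \<in> half_edges_at G v \<Longrightarrow> v \<in> verts G"
  using endpoint_verts[of "fst h" "snd h"] by (auto simp: half_edges_at_def)

lemma tau_cases: "e \<in> edges G \<Longrightarrow> \<tau> (e, b) = -1 \<or> \<tau> (e, b) = 1"
  using orientation by (auto simp: orientation_def)

lemma tau_opposite: "e \<in> edges G \<Longrightarrow> \<tau> (e, b) * \<tau> (e, \<not> b) = - \<sigma> e"
  using orientation by (cases b) (auto simp: orientation_def mult.commute)

lemma sigma_cases: "e \<in> edges G \<Longrightarrow> \<sigma> e = -1 \<or> \<sigma> e = 1"
  using signature by (auto simp: signature_def)

text \<open>The signed incidence matrix. Both half-edges of a loop lie at one vertex, so a positive
  loop has entry 0 there and a negative loop 2 or -2.\<close>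

definition incidence :: "'v \<Rightarrow> 'e \<Rightarrow> real" where
  "incidence v e = (\<Sum>b\<in>UNIV. if endpoint G (e, b) = v then real_of_int (\<tau> (e, b)) else 0)"

text \<open>Written as a matrix product for linear algebra; \<open>bdr_half_edges\<close> regroups
  it for arguments at a single vertex.\<close>

definition bdr :: "('e \<Rightarrow> real) \<Rightarrow> 'v \<Rightarrow> real" where
  "bdr x v = (\<Sum>e\<in>edges G. incidence v e * x e)"

text \<open>For a set \<open>F\<close> of edges: linear independence of the columns of the incidence
  matrix indexed by \<open>F\<close>.\<close>

definition independent :: "'e set \<Rightarrow> bool" where
  "independent F \<longleftrightarrow> (\<forall>z. (\<forall>e\<in>edges G - F. z e = 0) \<longrightarrow> (\<forall>v\<in>verts G. bdr z v = 0) \<longrightarrow> (\<forall>e\<in>F. z e = 0))"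

definition fractional :: "('e \<Rightarrow> real) \<Rightarrow> 'e set" where
  "fractional x = {e \<in> edges G. x e \<noteq> 0 \<and> x e \<noteq> 1}"

lemma bdr_half_edges:
  fixes x :: "'e \<Rightarrow> real"
  shows "bdr x v = (\<Sum>h\<in>half_edges_at G v. \<tau> h * x (fst h))"
proof -
  have "bdr x v = (\<Sum>e\<in>edges G. \<Sum>b\<in>UNIV. if endpoint G (e, b) = v then \<tau> (e, b) * x e else 0)"
    unfolding bdr_def incidence_def sum_distrib_right by (intro sum.cong refl) auto
  also have "\<dots> = (\<Sum>h\<in>edges G \<times> UNIV. if endpoint G h = v then \<tau> h * x (fst h) else 0)"
    by (simp add: sum.cartesian_product split_def del: prod.collapse) (simp only: prod.collapse)
  also have "\<dots> = (\<Sum>h\<in>{h \<in> edges G \<times> UNIV. endpoint G h = v}. \<tau> h * x (fst h))"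
    using finite_edges by (intro sum.inter_filter[symmetric]) auto
  also have "{h \<in> edges G \<times> UNIV. endpoint G h = v} = half_edges_at G v"
    by (auto simp: half_edges_at_def)
  finally show ?thesis .
qed

lemma boundary_eq_bdr: "real_of_int (boundary G \<tau> f v) = bdr (\<lambda>e. f e) v"
  by (simp add: boundary_def bdr_half_edges)

lemma bdr_add_scaled: "bdr (\<lambda>e. x e + c * z e) v = bdr x v + c * bdr z v"
  by (simp add: bdr_def distrib_left sum.distrib sum_distrib_left algebra_simps)

lemma finite_half_edges_at: "finite (half_edges_at G v)"
  by (rule finite_subset[of _ "edges G \<times> UNIV"]) (auto simp: half_edges_at_def finite_edges)

text \<open>Move from \<open>x\<close> in direction \<open>z\<close> until the first coordinate
  reaches 0 or 1. Integral coordinates stay fixed because \<open>z\<close> vanishes there, and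
  \<open>z d \<noteq> 0\<close> ensures that some fractional one moves.\<close>

lemma push_to_boundary:
  assumes x: "\<And>e. e \<in> edges G \<Longrightarrow> 0 \<le> x e \<and> x e \<le> 1"
    and z: "\<And>e. e \<in> edges G - fractional x \<Longrightarrow> z e = 0"
    and d: "d \<in> fractional x" "z d \<noteq> 0"
  obtains c where "\<And>e. e \<in> edges G \<Longrightarrow> 0 \<le> x e + c * z e \<and> x e + c * z e \<le> 1"
    "fractional (\<lambda>e. x e + c * z e) \<subset> fractional x"
proof -
  define S where "S = {e \<in> fractional x. z e \<noteq> 0}"
  \<comment> \<open>The step length at which coordinate \<open>e\<close> reaches the bound that
    \<open>z\<close> drives it towards: 1 if \<open>z e > 0\<close>, 0 if
    \<open>z e < 0\<close>.\<close>
  define l where "l e = (if z e > 0 then (1 - x e) / z e else - x e / z e)" for e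
  define c where "c = Min (l ` S)"
  have fS: "finite S" using finite_edges by (auto simp: S_def fractional_def)
  have Sx: "0 < x e" "x e < 1" "e \<in> edges G" if "e \<in> S" for e
    using that x[of e] by (auto simp: S_def fractional_def)
  have ne: "S \<noteq> {}" using d by (auto simp: S_def)
  have "c \<in> l ` S" unfolding c_def using fS ne by (intro Min_in) auto
  then obtain m where m: "m \<in> S" "c = l m" by blast
  have c0: "0 \<le> c" using Sx[OF m(1)] by (auto simp: m l_def divide_nonneg_neg divide_le_0_iff)
  have cle: "c \<le> l e" if "e \<in> S" for e unfolding c_def using fS that by (intro Min_le) auto
  have zm: "z m \<noteq> 0" using m by (auto simp: S_def)
  have hit: "x m + c * z m = 0 \<or> x m + c * z m = 1" using zm by (auto simp: m l_def)
  have bd: "0 \<le> x e + c * z e \<and> x e + c * z e \<le> 1" if e: "e \<in> edges G" for e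
  proof (cases "e \<in> S")
    case True
    show ?thesis
    proof (cases "z e > 0")
      case True
      then have "c * z e \<le> 1 - x e" using cle[OF \<open>e \<in> S\<close>] by (simp add: l_def pos_le_divide_eq)
      moreover have "0 \<le> c * z e" using c0 True by simp
      ultimately show ?thesis using Sx[OF \<open>e \<in> S\<close>] by auto
    next
      case False
      then have neg: "z e < 0" using \<open>e \<in> S\<close> by (auto simp: S_def)
      then have "- x e \<le> c * z e" using cle[OF \<open>e \<in> S\<close>] neg_le_divide_eq[OF neg, of c "- x e"]
        by (simp add: l_def)
      moreover have "c * z e \<le> 0" using c0 neg by (simp add: mult_nonneg_nonpos)
      ultimately show ?thesis using Sx[OF \<open>e \<in> S\<close>] by auto
    qed
  next
    case False
    then have "z e = 0" using z[of e] e by (auto simp: S_def)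
    then show ?thesis using x[OF e] by simp
  qed
  have "fractional (\<lambda>e. x e + c * z e) \<subseteq> fractional x"
    using z by (auto simp: fractional_def)
  moreover have "m \<in> fractional x" "m \<notin> fractional (\<lambda>e. x e + c * z e)"
    using m hit by (auto simp: S_def fractional_def)
  ultimately show thesis using that[of c] bd by blast
qed

text \<open>A solution with fewest fractional entries works: a nonzero vector on these entries with
  zero boundary would let \<open>push_to_boundary\<close> keep the boundary and lower their
  number.\<close>

lemma independent_fractional_solution:
  assumes "\<And>e. e \<in> edges G \<Longrightarrow> 0 \<le> x\<^sub>0 e \<and> x\<^sub>0 e \<le> 1"
  obtains x where "\<And>e. e \<in> edges G \<Longrightarrow> 0 \<le> x e \<and> x e \<le> 1"
    "\<And>v. v \<in> verts G \<Longrightarrow> bdr x v = bdr x\<^sub>0 v" "independent (fractional x)"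
proof -
  define P where "P x \<longleftrightarrow> (\<forall>e\<in>edges G. 0 \<le> x e \<and> x e \<le> 1) \<and> (\<forall>v\<in>verts G. bdr x v = bdr x\<^sub>0 v)" for x
  have "P x\<^sub>0" using assms by (auto simp: P_def)
  then obtain x where x: "P x" "\<And>y. P y \<Longrightarrow> card (fractional x) \<le> card (fractional y)"
    using ex_has_least_nat[of P x\<^sub>0 "\<lambda>x. card (fractional x)"] by blast
  have "independent (fractional x)"
    unfolding independent_def
  proof (intro allI impI ballI, rule ccontr)
    fix z d
    assume z: "\<forall>e\<in>edges G - fractional x. z e = 0" "\<forall>v\<in>verts G. bdr z v = 0"
      and d: "d \<in> fractional x" "z d \<noteq> 0"
    obtain c where c: "\<And>e. e \<in> edges G \<Longrightarrow> 0 \<le> x e + c * z e \<and> x e + c * z e \<le> 1"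
      "fractional (\<lambda>e. x e + c * z e) \<subset> fractional x"
      using push_to_boundary[of x z d] x(1) z(1) d unfolding P_def by blast
    have "P (\<lambda>e. x e + c * z e)"
      using c(1) x(1) z(2) by (auto simp: P_def bdr_add_scaled)
    from x(2)[OF this] show False
      using psubset_card_mono[OF _ c(2)] finite_edges by (auto simp: fractional_def)
  qed
  then show thesis using that x(1) by (auto simp: P_def)
qed

text \<open>Double counting of half-edges. Independence bounds \<open>card F\<close> by the number
  of vertices touched by \<open>F\<close>, so the degrees in \<open>F\<close> sum to at most twice
  that number; none of them is 0 or 1, so all are 2.\<close>

lemma independent_two_regular:
  assumes F: "F \<subseteq> edges G" "independent F"
    and deg: "\<And>v. card {h \<in> half_edges_at G v. fst h \<in> F} \<noteq> 1"
    and h: "fst h \<in> F"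
  shows "card {h' \<in> half_edges_at G (endpoint G h). fst h' \<in> F} = 2"
proof -
  define V where "V = endpoint G ` (F \<times> UNIV)"
  define D where "D v = {h \<in> half_edges_at G v. fst h \<in> F}" for v
  have fF: "finite F" using F finite_edges finite_subset by blast
  have fV: "finite V" using fF by (auto simp: V_def)
  have fD: "finite (D v)" for v using finite_half_edges_at by (auto simp: D_def)
  have le: "card F \<le> card V"
  proof (rule ccontr)
    assume "\<not> ?thesis"
    then obtain z where z: "\<exists>e\<in>F. z e \<noteq> 0" "\<forall>e. e \<notin> F \<longrightarrow> z e = 0"
      "\<forall>v\<in>V. (\<Sum>e\<in>F. incidence v e * z e) = 0"
      using homogeneous_system_nontrivial[OF fV fF, of incidence] by (auto simp: not_le)
    \<comment> \<open>Vertices outside \<open>V\<close> meet no edge of \<open>F\<close>, so they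
      impose no further equation.\<close>
    have "bdr z v = 0" for v
    proof -
      have "bdr z v = (\<Sum>e\<in>F. incidence v e * z e)"
        unfolding bdr_def using F(1) z(2) finite_edges by (intro sum.mono_neutral_right) auto
      moreover have "(\<Sum>e\<in>F. incidence v e * z e) = 0"
      proof (cases "v \<in> V")
        case False
        then have "endpoint G (e, b) \<noteq> v" if "e \<in> F" for e b using that by (auto simp: V_def)
        then show ?thesis by (simp add: incidence_def)
      qed (use z in auto)
      ultimately show ?thesis by simp
    qed
    then show False using F(2) z unfolding independent_def by blast
  qed
  have two: "2 \<le> card (D v)" if v: "v \<in> V" for v
  proof -
    obtain e b where "e \<in> F" "endpoint G (e, b) = v" using v by (auto simp: V_def)
    then have "(e, b) \<in> D v" using F(1) by (auto simp: D_def half_edges_at_def)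
    then have "card (D v) \<noteq> 0" using fD by auto
    then show ?thesis using deg[of v] unfolding D_def by linarith
  qed
  have "(\<Sum>v\<in>V. card (D v)) = card (F \<times> (UNIV :: bool set))"
  proof -
    have "card (F \<times> (UNIV :: bool set)) = (\<Sum>v\<in>V. \<Sum>h\<in>{h. h \<in> F \<times> UNIV \<and> endpoint G h = v}. 1)"
      unfolding card_eq_sum V_def using fF by (intro sum.image_gen) auto
    also have "\<dots> = (\<Sum>v\<in>V. card (D v))"
    proof (intro sum.cong refl)
      fix v
      have "{h. h \<in> F \<times> UNIV \<and> endpoint G h = v} = D v"
        using F(1) by (auto simp: D_def half_edges_at_def)
      then show "(\<Sum>h\<in>{h. h \<in> F \<times> UNIV \<and> endpoint G h = v}. 1) = card (D v)" by simp
    qed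
    finally show ?thesis by simp
  qed
  also have "\<dots> \<le> (\<Sum>v\<in>V. 2)" using le by (simp add: card_cartesian_product)
  finally have sum_le: "(\<Sum>v\<in>V. card (D v)) \<le> (\<Sum>v\<in>V. 2)" .
  have hV: "endpoint G h \<in> V" using h by (cases h) (auto simp: V_def)
  have "card (D (endpoint G h)) = 2"
  proof (rule ccontr)
    assume "card (D (endpoint G h)) \<noteq> 2"
    then have "2 < card (D (endpoint G h))" using two[OF hV] by linarith
    then have "(\<Sum>v\<in>V. 2) < (\<Sum>v\<in>V. card (D v))"
      using fV hV two by (intro sum_strict_mono_ex1) auto
    with sum_le show False by simp
  qed
  then show ?thesis by (simp add: D_def)
qed

section \<open>Circuits\<close>

text \<open>A walk that never turns back along the edge it came from closes up to a circuit.\<close>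

lemma circuit_exists:
  assumes H: "finite H" "h\<^sub>0 \<in> H" "fst ` H \<subseteq> edges G"
    and opp: "\<And>e b. (e, b) \<in> H \<Longrightarrow> (e, \<not> b) \<in> H"
    and other: "\<And>h. h \<in> H \<Longrightarrow> \<exists>h'\<in>H. h' \<noteq> h \<and> endpoint G h' = endpoint G h"
  obtains vs es where "circuit G vs es" "set es \<subseteq> fst ` H" "set vs \<subseteq> endpoint G ` H"
proof -
  define opposite :: "'e half_edge \<Rightarrow> 'e half_edge" where "opposite h = (fst h, \<not> snd h)" for h
  obtain p where p: "\<And>h. h \<in> H \<Longrightarrow> p h \<in> H \<and> p h \<noteq> h \<and> endpoint G (p h) = endpoint G h"
    using other by metis
  \<comment> \<open>Each step crosses the current edge and departs by a half-edge other than the one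
    of arrival.\<close>
  define g where "g = rec_nat h\<^sub>0 (\<lambda>_ h. p (opposite h))"
  have g_Suc: "g (Suc i) = p (opposite (g i))" for i by (simp add: g_def)
  have op: "opposite h \<in> H" if "h \<in> H" for h using opp[of "fst h" "snd h"] that by (simp add: opposite_def)
  have gH: "g i \<in> H" for i
    by (induction i) (use H p op in \<open>auto simp: g_def\<close>)
  have step: "endpoint G (g (Suc i)) = endpoint G (opposite (g i))" "g (Suc i) \<noteq> opposite (g i)" for i
    using p[OF op[OF gH]] by (auto simp: g_Suc)
  define w where "w i = endpoint G (g i)" for i
  define P where "P j \<longleftrightarrow> (\<exists>i<j. w i = w j)" for j
  have "finite (range w)" using gH H(1) by (intro finite_subset[of "range w" "endpoint G ` H"]) (auto simp: w_def)
  then have "\<not> inj w" using finite_imageD by blast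
  then obtain a b where "w a = w b" "a \<noteq> b" by (auto simp: inj_def)
  then have "\<exists>j. P j" unfolding P_def by (metis linorder_neqE_nat)
  \<comment> \<open>At the first recurrence \<open>w i = w j\<close> the vertices from
    \<open>i\<close> to \<open>j - 1\<close> are distinct and close up.\<close>
  then obtain j where j: "P j" "\<And>m. m < j \<Longrightarrow> \<not> P m"
    using exists_least_iff[of P] by blast
  from j(1) obtain i where i: "i < j" "w i = w j" by (auto simp: P_def)
  have inj: "a = b" if "a < j" "b < j" "w a = w b" for a b
    using j(2) that unfolding P_def by (metis linorder_neqE_nat)
  \<comment> \<open>An edge used at \<open>a < b\<close> starts from different vertices, hence is
    traversed in opposite directions. Then \<open>w b = w (Suc a)\<close>, so
    \<open>b = Suc a\<close>, an immediate reversal.\<close>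
  have inj_e: "a = b" if ab: "i \<le> a" "i \<le> b" "a < j" "b < j" and eq: "fst (g a) = fst (g b)" for a b
    using ab eq
  proof (induction a b rule: linorder_wlog)
    case (le a b)
    show ?case
    proof (rule ccontr)
      assume "a \<noteq> b"
      with le have "a < b" by simp
      have "g a \<noteq> g b" using inj[of a b] le \<open>a \<noteq> b\<close> by (auto simp: w_def)
      then have gb: "g b = opposite (g a)" using le by (auto simp: opposite_def prod_eq_iff)
      then have "w b = w (Suc a)" by (simp add: w_def step)
      then have "b = Suc a" using inj[of b "Suc a"] le \<open>a < b\<close> by simp
      with gb step(2) show False by simp
    qed
  qed (metis)
  define vs where "vs = map w [i..<j]"
  define es where "es = map (\<lambda>m. fst (g m)) [i..<j]"
  have "circuit G vs es"
    unfolding circuit_def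
  proof (intro conjI allI impI)
    show "vs \<noteq> []" using i by (simp add: vs_def)
    show "length es = length vs" by (simp add: vs_def es_def)
    show "distinct vs" using inj by (auto simp: vs_def distinct_map inj_on_def)
    show "distinct es" using inj_e by (auto simp: es_def distinct_map inj_on_def)
    fix m assume m: "m < length vs"
    then have m': "i + m < j" by (simp add: vs_def)
    have "vs ! (Suc m mod length vs) = w (Suc (i + m))"
    proof (cases "Suc m < length vs")
      case True
      then show ?thesis by (simp add: vs_def)
    next
      case False
      with m have "Suc m = length vs" by simp
      moreover from this have "Suc (i + m) = j" using i by (simp add: vs_def)
      ultimately show ?thesis using i by (simp add: vs_def)
    qed
    moreover have "joins G (fst (g (i + m))) (w (i + m)) (w (Suc (i + m)))"
      unfolding joins_def
      using gH[of "i + m"] H(3) step(1)[of "i + m"]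
      by (intro conjI exI[of _ "snd (g (i + m))"]) (auto simp: w_def opposite_def)
    ultimately show "joins G (es ! m) (vs ! m) (vs ! (Suc m mod length vs))"
      using m by (simp add: es_def vs_def)
  qed
  moreover have "set es \<subseteq> fst ` H" "set vs \<subseteq> endpoint G ` H"
    using gH by (auto simp: es_def vs_def w_def)
  ultimately show thesis using that by blast
qed

text \<open>Fixes a direction of traversal: \<open>\<beta> i\<close> labels the half-edge by which
  edge \<open>i\<close> leaves \<open>vs ! i\<close>.\<close>

lemma circuit_half_edges:
  assumes "circuit G vs es"
  obtains \<beta> where
    "\<And>i. i < length vs \<Longrightarrow> es ! i \<in> edges G"
    "\<And>i. i < length vs \<Longrightarrow> endpoint G (es ! i, \<beta> i) = vs ! i"
    "\<And>i. i < length vs \<Longrightarrow> endpoint G (es ! i, \<not> \<beta> i) = vs ! (Suc i mod length vs)"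
proof -
  have "\<forall>i. \<exists>b. i < length vs \<longrightarrow> es ! i \<in> edges G \<and> endpoint G (es ! i, b) = vs ! i \<and>
      endpoint G (es ! i, \<not> b) = vs ! (Suc i mod length vs)"
    using assms by (auto simp: circuit_def joins_def)
  then show thesis using that by metis
qed

lemma circuit_edges_subset: "circuit G vs es \<Longrightarrow> set es \<subseteq> edges G"
  by (auto simp: circuit_def joins_def in_set_conv_nth)

lemma circuit_endpoint:
  assumes "circuit G vs es" "fst h \<in> set es"
  shows "endpoint G h \<in> set vs"
proof -
  obtain \<beta> where \<beta>: "\<And>i. i < length vs \<Longrightarrow> es ! i \<in> edges G"
    "\<And>i. i < length vs \<Longrightarrow> endpoint G (es ! i, \<beta> i) = vs ! i"
    "\<And>i. i < length vs \<Longrightarrow> endpoint G (es ! i, \<not> \<beta> i) = vs ! (Suc i mod length vs)"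
    using circuit_half_edges[OF assms(1)] by blast
  obtain i where i: "i < length vs" "fst h = es ! i"
    using assms by (auto simp: circuit_def in_set_conv_nth)
  then have "h = (es ! i, \<beta> i) \<or> h = (es ! i, \<not> \<beta> i)" by (auto simp: prod_eq_iff)
  moreover have "Suc i mod length vs < length vs" using i by (intro mod_less_divisor) auto
  ultimately show ?thesis using \<beta> i by auto
qed

lemma circuit_two_half_edges:
  assumes "circuit G vs es" "v \<in> set vs"
  obtains h h' where "h \<noteq> h'" "fst h \<in> set es" "fst h' \<in> set es"
    "h \<in> half_edges_at G v" "h' \<in> half_edges_at G v"
proof -
  obtain \<beta> where \<beta>: "\<And>i. i < length vs \<Longrightarrow> es ! i \<in> edges G"
    "\<And>i. i < length vs \<Longrightarrow> endpoint G (es ! i, \<beta> i) = vs ! i"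
    "\<And>i. i < length vs \<Longrightarrow> endpoint G (es ! i, \<not> \<beta> i) = vs ! (Suc i mod length vs)"
    using circuit_half_edges[OF assms(1)] by blast
  have len: "length es = length vs" "distinct es" using assms by (auto simp: circuit_def)
  obtain i where i: "i < length vs" "v = vs ! i" using assms by (auto simp: in_set_conv_nth)
  \<comment> \<open>The cyclic predecessor, whose edge arrives at \<open>v\<close>. In a circuit of
    length 1 it is \<open>i\<close> itself, and the two half-edges differ only in their
    labels.\<close>
  define j where "j = (if i = 0 then length vs - 1 else i - 1)"
  have j: "j < length vs" "Suc j mod length vs = i" using i by (auto simp: j_def)
  have "(es ! i, \<beta> i) \<noteq> (es ! j, \<not> \<beta> j)"
    using len i j by (auto simp: nth_eq_iff_index_eq)
  then show thesis
    using that[of "(es ! i, \<beta> i)" "(es ! j, \<not> \<beta> j)"] \<beta> i j len by (auto simp: half_edges_at_def)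
qed

lemma prod_sigma:
  assumes "distinct es" "set es \<subseteq> edges G"
  shows "(\<Prod>i<length es. \<sigma> (es ! i)) = (if balanced \<sigma> es then 1 else -1)"
proof -
  have "(\<Prod>i<length es. \<sigma> (es ! i)) = (\<Prod>e\<in>set es. \<sigma> e)"
    using bij_betw_nth[OF assms(1) refl refl] by (rule prod.reindex_bij_betw)
  also have "\<dots> = (\<Prod>e\<in>set es. if \<sigma> e = -1 then -1 else 1)"
    using assms(2) sigma_cases by (intro prod.cong) force+
  also have "\<dots> = (-1) ^ card {e \<in> set es. \<sigma> e = -1}"
    by (simp add: prod.inter_filter[symmetric])
  finally show ?thesis by (simp add: balanced_def)
qed

text \<open>A balanced circuit supports a nonzero vector with zero boundary, which makes its edges
  dependent.\<close>

lemma circuit_unbalanced_if_independent: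
  assumes C: "circuit G vs es" and F: "set es \<subseteq> F" "independent F"
  shows "\<not> balanced \<sigma> es"
proof
  assume bal: "balanced \<sigma> es"
  obtain \<beta> where \<beta>: "\<And>i. i < length vs \<Longrightarrow> es ! i \<in> edges G"
    "\<And>i. i < length vs \<Longrightarrow> endpoint G (es ! i, \<beta> i) = vs ! i"
    "\<And>i. i < length vs \<Longrightarrow> endpoint G (es ! i, \<not> \<beta> i) = vs ! (Suc i mod length vs)"
    using circuit_half_edges[OF C] by blast
  define n where "n = length vs"
  have n: "length es = n" "n > 0" "distinct es" using C by (auto simp: circuit_def n_def)
  \<comment> \<open>A unit of flow sent around the circuit changes sign at each negative edge, so it returns with
    its initial sign if the circuit is balanced.\<close>
  define y where "y i = (\<Prod>j\<le>i. \<sigma> (es ! j))" for i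
  \<comment> \<open>Chosen so that the signed contribution of edge \<open>i\<close> at its far end
    is \<open>y i\<close>.\<close>
  define z where "z i = \<tau> (es ! i, \<not> \<beta> i) * y i" for i
  define Z where "Z e = (\<Sum>i<n. if e = es ! i then real_of_int (z i) else 0)" for e
  have yi: "y (n - 1) = 1"
  proof -
    have "{..n - 1} = {..<n}" using n(2) by auto
    then show ?thesis using prod_sigma[OF n(3) circuit_edges_subset[OF C]] bal n by (simp add: y_def)
  qed
  have sq: "\<tau> (es ! i, b) * \<tau> (es ! i, b) = 1" "\<sigma> (es ! i) * \<sigma> (es ! i) = 1" if "i < n" for i b
    using tau_cases[of "es ! i" b] sigma_cases[of "es ! i"] \<beta>(1) that by (auto simp: n_def)
  have out: "\<tau> (es ! i, \<not> \<beta> i) * z i = y i" if "i < n" for i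
    using sq(1)[OF that, of "\<not> \<beta> i"] by (simp add: z_def mult.assoc[symmetric])
  have inn: "\<tau> (es ! i, \<beta> i) * z i = - \<sigma> (es ! i) * y i" if "i < n" for i
    using tau_opposite[of "es ! i" "\<beta> i"] \<beta>(1) that by (simp add: z_def mult.assoc[symmetric] n_def)
  \<comment> \<open>The next edge cancels what edge \<open>i\<close> contributes at their common
    vertex. Balance enters at the wrap-around, through \<open>y (n - 1) = 1\<close>.\<close>
  have cancel: "\<tau> (es ! (Suc i mod n), \<beta> (Suc i mod n)) * z (Suc i mod n) = - y i" if "i < n" for i
  proof (cases "Suc i < n")
    case True
    then show ?thesis
      using inn[of "Suc i"] sq(2)[of "Suc i"] by (simp add: y_def mult_ac)
  next
    case False
    with that have "Suc i = n" by simp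
    then show ?thesis using inn[of 0] sq(2)[of 0] yi n(2) by (auto simp: y_def)
  qed
  have inc: "incidence v (es ! i) = (if vs ! i = v then \<tau> (es ! i, \<beta> i) else 0)
      + (if vs ! (Suc i mod n) = v then \<tau> (es ! i, \<not> \<beta> i) else 0)" if "i < n" for v i
    using \<beta>(2,3)[of i] that by (cases "\<beta> i") (auto simp: incidence_def UNIV_bool n_def)
  have "bdr Z v = 0" for v
  proof -
    \<comment> \<open>The contribution at \<open>v\<close> of the half-edge leaving
      \<open>vs ! i\<close>. By \<open>cancel\<close>, edge \<open>i\<close> contributes a
      difference of neighbouring terms, so the cyclic sum vanishes.\<close>
    define g where "g i = (if vs ! i = v then real_of_int (\<tau> (es ! i, \<beta> i) * z i) else 0)" for i
    have "bdr Z v = (\<Sum>e\<in>edges G. \<Sum>i<n. if e = es ! i then incidence v e * z i else 0)"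
      unfolding bdr_def Z_def sum_distrib_left by (intro sum.cong refl) auto
    also have "\<dots> = (\<Sum>i<n. \<Sum>e\<in>edges G. if e = es ! i then incidence v e * z i else 0)"
      by (rule sum.swap)
    also have "\<dots> = (\<Sum>i<n. incidence v (es ! i) * z i)"
      using \<beta>(1) finite_edges by (intro sum.cong) (auto simp: n_def sum.delta')
    also have "\<dots> = (\<Sum>i<n. g i - g (Suc i mod n))"
    proof (intro sum.cong refl)
      fix i assume "i \<in> {..<n}"
      then have i: "i < n" by simp
      then have "real_of_int (\<tau> (es ! i, \<not> \<beta> i)) * z i = y i"
        using out[OF i] by (metis of_int_mult)
      then show "incidence v (es ! i) * z i = g i - g (Suc i mod n)"
        unfolding inc[OF i] g_def cancel[OF i] by (auto simp: distrib_right)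
    qed
    also have "\<dots> = 0" by (simp add: sum_subtractf sum_cyclic_shift)
    finally show ?thesis .
  qed
  moreover have "Z e = 0" if "e \<notin> F" for e
    unfolding Z_def using F(1) n(1) that by (intro sum.neutral) (auto dest: nth_mem)
  ultimately have "\<forall>e\<in>F. Z e = 0" using F(2) unfolding independent_def by blast
  then have "Z (es ! 0) = 0" using F(1) n(1,2) nth_mem[of 0 es] by (simp add: subset_iff)
  moreover have "Z (es ! 0) = z 0"
  proof -
    have "Z (es ! 0) = (\<Sum>i<n. if i = 0 then real_of_int (z i) else 0)"
      unfolding Z_def using n by (intro sum.cong refl) (auto simp: nth_eq_iff_index_eq)
    then show ?thesis using n by simp
  qed
  moreover have "z 0 \<noteq> 0" using out[of 0] n(2) sq(2)[of 0] by (auto simp: y_def)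
  ultimately show False by simp
qed

text \<open>A shortest walk between the two vertex sets repeats no vertex and meets each circuit
  only at its end.\<close>

lemma joining_path:
  assumes "circuit G us cs" "circuit G vs ds" "set us \<inter> set vs = {}"
    and "(a, b) \<in> {(u, v). \<exists>e. joins G e u v}\<^sup>*" "a \<in> set us" "b \<in> set vs"
  obtains ps qs where "path G ps qs" "set ps \<inter> set us = {hd ps}" "set ps \<inter> set vs = {last ps}"
proof -
  obtain p n where p: "p 0 \<in> set us" "p n \<in> set vs"
    "\<And>i. i < n \<Longrightarrow> (p i, p (Suc i)) \<in> {(u, v). \<exists>e. joins G e u v}"
    "inj_on p {..n}" "\<And>i. i \<le> n \<Longrightarrow> p i \<in> set us \<Longrightarrow> i = 0" "\<And>i. i \<le> n \<Longrightarrow> p i \<in> set vs \<Longrightarrow> i = n"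
    using shortest_walk[OF assms(4-6)] by blast
  obtain e where e: "\<And>i. i < n \<Longrightarrow> joins G (e i) (p i) (p (Suc i))"
    using p(3) by (simp, metis)
  \<comment> \<open>Hence \<open>p n\<close>, too, is an end of an edge and therefore a vertex of
    \<open>G\<close>.\<close>
  have "n \<noteq> 0" using p(1,2) assms(3) by (metis disjoint_iff)
  define ps where "ps = map p [0..<Suc n]"
  define qs where "qs = map e [0..<n]"
  have set_ps: "set ps = p ` {..n}"
    by (simp add: ps_def atLeast0LessThan lessThan_Suc_atMost del: upt_Suc)
  have ends: "hd ps = p 0" "last ps = p n" by (simp_all add: ps_def hd_map last_map del: upt_Suc)
  have "p i \<in> verts G" if "i \<le> n" for i
  proof (cases "i < n")
    case True
    then show ?thesis using joins_verts e by blast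
  next
    case False
    with that \<open>n \<noteq> 0\<close> have "i = Suc (n - 1)" "n - 1 < n" by auto
    then show ?thesis using joins_verts e by metis
  qed
  moreover have "distinct ps"
    using p(4) by (simp add: ps_def distinct_map atLeast0LessThan lessThan_Suc_atMost del: upt_Suc)
  moreover have "joins G (qs ! i) (ps ! i) (ps ! Suc i)" if "i < length qs" for i
    using e[of i] that by (simp add: ps_def qs_def del: upt_Suc)
  ultimately have "path G ps qs"
    by (auto simp: path_def set_ps) (simp add: ps_def qs_def)
  moreover have "set ps \<inter> set us = {hd ps}" "set ps \<inter> set vs = {last ps}"
    using p unfolding set_ps ends by (auto; metis atMost_iff)+
  ultimately show thesis using that by blast
qed

section \<open>Fractional edges\<close>

text \<open>At each vertex the signed fractional entries sum to an integer, which a single entry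
  strictly between 0 and 1 cannot do. With degree 1 excluded, \<open>independent_two_regular\<close>
  applies; independence then kills \<open>2 x - 1\<close> on the fractional edges.\<close>

lemma fractional_half:
  assumes x: "\<And>e. e \<in> edges G \<Longrightarrow> 0 \<le> x e \<and> x e \<le> 1"
    and int: "\<And>v. v \<in> verts G \<Longrightarrow> bdr x v \<in> \<int>"
    and ind: "independent (fractional x)"
  shows "h \<in> half_edges_at G v \<Longrightarrow> fst h \<in> fractional x
      \<Longrightarrow> card {h' \<in> half_edges_at G v. fst h' \<in> fractional x} = 2"
    and "e \<in> fractional x \<Longrightarrow> x e = 1 / 2"
proof -
  define D where "D v = {h \<in> half_edges_at G v. fst h \<in> fractional x}" for v
  have fD: "finite (D v)" for v using finite_half_edges_at by (auto simp: D_def)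
  have tau: "\<tau> h = -1 \<or> \<tau> h = 1" "0 < x (fst h)" "x (fst h) < 1" if "h \<in> D v" for h v
    using that tau_cases[of "fst h" "snd h"] x[of "fst h"]
    by (auto simp: D_def fractional_def half_edges_at_def)
  have int_D: "(\<Sum>h\<in>D v. \<tau> h * x (fst h)) \<in> \<int>" if v: "v \<in> verts G" for v
  proof -
    have "bdr x v = (\<Sum>h\<in>D v. \<tau> h * x (fst h)) + (\<Sum>h\<in>half_edges_at G v - D v. \<tau> h * x (fst h))"
      unfolding bdr_half_edges using finite_half_edges_at
      by (subst add.commute, intro sum.subset_diff) (auto simp: D_def)
    moreover have "(\<Sum>h\<in>half_edges_at G v - D v. \<tau> h * x (fst h)) \<in> \<int>"
      by (intro Ints_sum) (auto simp: D_def fractional_def half_edges_at_def)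
    ultimately show ?thesis using int[OF v] Ints_diff by fastforce
  qed
  have small: "a = 0" if "a \<in> \<int>" "-1 < a" "a < 1" for a :: real
    using that by (auto elim!: Ints_cases)
  have D_verts: "v \<in> verts G" if "h \<in> D v" for h v
    using that half_edges_at_verts unfolding D_def by blast
  have "card (D v) \<noteq> 1" for v
  proof
    assume "card (D v) = 1"
    then obtain h where h: "D v = {h}" by (auto simp: card_1_singleton_iff)
    then have "\<tau> h * x (fst h) \<in> \<int>" using int_D[of v] D_verts[of h v] by simp
    then show False using tau[of h v] h small[of "\<tau> h * x (fst h)"] by auto
  qed
  then have two: "card (D (endpoint G h)) = 2" if "fst h \<in> fractional x" for h
    unfolding D_def using independent_two_regular[OF _ ind _ that] by (auto simp: fractional_def)
  then show "h \<in> half_edges_at G v \<Longrightarrow> fst h \<in> fractional x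
      \<Longrightarrow> card {h' \<in> half_edges_at G v. fst h' \<in> fractional x} = 2"
    unfolding D_def half_edges_at_def by blast
  \<comment> \<open>At a vertex with two fractional half-edges \<open>h\<close>, \<open>h'\<close>, the boundary of \<open>2 x - 1\<close> vanishes:
    integrality gives \<open>x h + x h' = 1\<close> if their signs agree and \<open>x h = x h'\<close> otherwise.\<close>
  define z where "z e = (if e \<in> fractional x then 2 * x e - 1 else 0)" for e
  have "bdr z v = 0" for v
  proof -
    have "bdr z v = (\<Sum>h\<in>D v. \<tau> h * (2 * x (fst h) - 1))"
      unfolding bdr_half_edges z_def D_def using finite_half_edges_at
      by (subst sum.inter_filter) (auto intro!: sum.cong)
    also have "\<dots> = 0"
    proof (cases "D v = {}")
      case False
      then obtain d where d: "d \<in> D v" by blast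
      then have "card (D v) = 2" using two[of d] by (auto simp: D_def half_edges_at_def)
      then obtain h h' where h: "D v = {h, h'}" "h \<noteq> h'" by (auto simp: card_2_iff)
      have s: "\<tau> h * x (fst h) + \<tau> h' * x (fst h') \<in> \<int>" using int_D[of v] D_verts[OF d] h by simp
      have t: "\<tau> h = -1 \<or> \<tau> h = 1" "\<tau> h' = -1 \<or> \<tau> h' = 1"
        and b: "0 < x (fst h)" "x (fst h) < 1" "0 < x (fst h')" "x (fst h') < 1"
        using tau h by blast+
      have *: "x (fst h) + x (fst h') - 1 = 0" if "\<tau> h = \<tau> h'"
      proof (rule small)
        have "x (fst h) + x (fst h') = \<tau> h * (\<tau> h * x (fst h) + \<tau> h' * x (fst h'))"
          using that t by auto
        then have "x (fst h) + x (fst h') \<in> \<int>" using s by (metis Ints_mult Ints_of_int)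
        then show "x (fst h) + x (fst h') - 1 \<in> \<int>" by simp
      qed (use b in auto)
      have **: "x (fst h) - x (fst h') = 0" if "\<tau> h \<noteq> \<tau> h'"
      proof (rule small)
        have "x (fst h) - x (fst h') = \<tau> h * (\<tau> h * x (fst h) + \<tau> h' * x (fst h'))"
          using that t by auto
        then show "x (fst h) - x (fst h') \<in> \<int>" using s by (metis Ints_mult Ints_of_int)
      qed (use b in auto)
      show ?thesis using * ** h t by (cases "\<tau> h = \<tau> h'") auto
    qed simp
    finally show ?thesis .
  qed
  moreover have "\<forall>e\<in>edges G - fractional x. z e = 0" by (auto simp: z_def)
  ultimately have "\<forall>e\<in>fractional x. z e = 0" using ind unfolding independent_def by blast
  then show "x e = 1 / 2" if "e \<in> fractional x" using that by (auto simp: z_def)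
qed

text \<open>Both half-edges lie in \<open>W\<close> or neither does. For an edge of \<open>G\<close>
  the sum is thus 0, or 2 or -2 for a negative edge inside \<open>W\<close>: the source of the
  parity argument.\<close>

lemma sum_incidence_closed:
  assumes "finite W" and closed: "\<And>b. endpoint G (e, b) \<in> W \<longleftrightarrow> endpoint G (e, \<not> b) \<in> W"
  shows "(\<Sum>v\<in>W. incidence v e)
    = (if endpoint G (e, False) \<in> W then real_of_int (\<tau> (e, False) + \<tau> (e, True)) else 0)"
proof -
  have "(\<Sum>v\<in>W. incidence v e) = (\<Sum>b\<in>UNIV. if endpoint G (e, b) \<in> W then real_of_int (\<tau> (e, b)) else 0)"
    unfolding incidence_def using assms(1) by (subst sum.swap) (auto intro!: sum.cong)
  then show ?thesis using closed[of False] by (simp add: UNIV_bool)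
qed

text \<open>The contradiction arises in the component \<open>W\<close> of one fractional circuit
  \<open>cs\<close>: another fractional edge in \<open>W\<close> yields a long barbell, and without
  one a parity count makes \<open>cs\<close> balanced.\<close>

lemma fractional_empty:
  fixes f :: "'e \<Rightarrow> int"
  assumes "odd k" and f: "\<And>v. v \<in> verts G \<Longrightarrow> k dvd boundary G \<tau> f v"
    and nb: "\<not> contains_long_barbell G \<sigma>"
    and x: "\<And>e. e \<in> edges G \<Longrightarrow> 0 \<le> x e \<and> x e \<le> 1"
    and bdr: "\<And>v. v \<in> verts G \<Longrightarrow> real_of_int k * bdr x v = real_of_int (boundary G \<tau> f v)"
    and ind: "independent (fractional x)"
  shows "fractional x = {}"
proof (rule ccontr)
  assume "fractional x \<noteq> {}"
  then obtain e\<^sub>0 where e\<^sub>0: "e\<^sub>0 \<in> fractional x" by blast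
  define F where "F = fractional x"
  have FE: "F \<subseteq> edges G" by (auto simp: F_def fractional_def)
  have fF: "finite F" using FE finite_edges finite_subset by blast
  have k0: "k \<noteq> 0" using \<open>odd k\<close> by auto
  have int: "bdr x v \<in> \<int>" if v: "v \<in> verts G" for v
  proof -
    obtain m where "boundary G \<tau> f v = k * m" using f[OF v] by blast
    then show ?thesis using bdr[OF v] k0 by simp
  qed
  have two: "card {h' \<in> half_edges_at G v. fst h' \<in> F} = 2"
    if "h \<in> half_edges_at G v" "fst h \<in> F" for h v
    using fractional_half(1)[OF x int ind] that unfolding F_def by blast
  have half: "x e = 1 / 2" if "e \<in> F" for e
    using fractional_half(2)[OF x int ind] that unfolding F_def by blast
  \<comment> \<open>The fractional degree at \<open>v\<close> is 2, so two known half-edges exhaust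
    it.\<close>
  have third: "h = h1 \<or> h = h2" if "h \<in> half_edges_at G v" "h1 \<in> half_edges_at G v"
    "h2 \<in> half_edges_at G v" "fst h \<in> F" "fst h1 \<in> F" "fst h2 \<in> F" "h1 \<noteq> h2" for h h1 h2 v
  proof (rule ccontr)
    assume "\<not> ?thesis"
    then have "card {h, h1, h2} = 3" using that by auto
    moreover have "card {h, h1, h2} \<le> card {h' \<in> half_edges_at G v. fst h' \<in> F}"
      using that finite_half_edges_at by (intro card_mono) auto
    ultimately show False using two[of h v] that by simp
  qed
  have another: "\<exists>h'. h' \<noteq> h \<and> fst h' \<in> F \<and> h' \<in> half_edges_at G (endpoint G h)" if "fst h \<in> F" for h
  proof -
    have "h \<in> half_edges_at G (endpoint G h)" using that FE by (auto simp: half_edges_at_def)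
    from two[OF this that] obtain a b where
      "{h' \<in> half_edges_at G (endpoint G h). fst h' \<in> F} = {a, b}" "a \<noteq> b"
      by (auto simp: card_2_iff)
    then have "fst a \<in> F" "a \<in> half_edges_at G (endpoint G h)"
      "fst b \<in> F" "b \<in> half_edges_at G (endpoint G h)" by blast+
    then show ?thesis using \<open>a \<noteq> b\<close> by metis
  qed
  have other: "\<exists>h'\<in>F \<times> UNIV. h' \<noteq> h \<and> endpoint G h' = endpoint G h" if h: "h \<in> F \<times> UNIV" for h
  proof -
    obtain h' where "h' \<noteq> h" "fst h' \<in> F" "h' \<in> half_edges_at G (endpoint G h)"
      using another[of h] h by (metis mem_Times_iff)
    then show ?thesis by (intro bexI[of _ h']) (auto simp: half_edges_at_def mem_Times_iff)
  qed
  have FU: "finite (F \<times> (UNIV :: bool set))" "(e\<^sub>0, True) \<in> F \<times> UNIV"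
    "fst ` (F \<times> (UNIV :: bool set)) \<subseteq> edges G"
    "(e, b) \<in> F \<times> UNIV \<Longrightarrow> (e, \<not> b) \<in> F \<times> UNIV" for e b
    using fF e\<^sub>0 FE by (auto simp: F_def)
  obtain us cs where "circuit G us cs" "set cs \<subseteq> fst ` (F \<times> (UNIV :: bool set))"
    "set us \<subseteq> endpoint G ` (F \<times> UNIV)"
    by (rule circuit_exists[OF FU other])
  then have C: "circuit G us cs" "set cs \<subseteq> F" by auto
  have unb: "\<not> balanced \<sigma> cs"
    using circuit_unbalanced_if_independent[OF C(1), of F] C(2) ind by (simp add: F_def)
  define R where "R = {(u, v). \<exists>e. joins G e u v}"
  \<comment> \<open>The vertex set of the component of \<open>G\<close> that contains
    \<open>cs\<close>.\<close>
  define W where "W = {v. \<exists>u\<in>set us. (u, v) \<in> R\<^sup>*}"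
  have closed: "endpoint G (e, \<not> b) \<in> W" if "e \<in> edges G" "endpoint G (e, b) \<in> W" for e b
  proof -
    have "(endpoint G (e, b), endpoint G (e, \<not> b)) \<in> R"
      using that by (auto simp: R_def joins_def)
    then show ?thesis using that(2) unfolding W_def by (blast intro: rtrancl_into_rtrancl)
  qed
  have closed': "endpoint G (e, b) \<in> W \<longleftrightarrow> endpoint G (e, \<not> b) \<in> W" if "e \<in> edges G" for e b
    using closed[of e b] closed[of e "\<not> b"] that by auto
  have usW: "set us \<subseteq> W" by (auto simp: W_def)
  have us_verts: "set us \<subseteq> verts G"
    using circuit_two_half_edges[OF C(1)] half_edges_at_verts by blast
  have W_verts: "W \<subseteq> verts G"
  proof
    fix v assume "v \<in> W"
    then obtain u where u: "u \<in> set us" "(u, v) \<in> R\<^sup>*" by (auto simp: W_def)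
    from u(2) show "v \<in> verts G"
      by (cases rule: rtranclE) (use u(1) us_verts joins_verts in \<open>auto simp: R_def\<close>)
  qed
  then have fW: "finite W" using finite_verts finite_subset by blast
  \<comment> \<open>The circuit already uses both fractional half-edges at each of its
    vertices.\<close>
  have on_us: "fst h \<in> set cs" if h: "fst h \<in> F" "endpoint G h \<in> set us" for h
  proof -
    obtain h1 h2 where "h1 \<noteq> h2" "fst h1 \<in> set cs" "fst h2 \<in> set cs"
      "h1 \<in> half_edges_at G (endpoint G h)" "h2 \<in> half_edges_at G (endpoint G h)"
      using circuit_two_half_edges[OF C(1) h(2)] by blast
    moreover have "h \<in> half_edges_at G (endpoint G h)" using h FE by (auto simp: half_edges_at_def)
    ultimately show ?thesis using third[of h _ h1 h2] C(2) h by blast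
  qed
  have only: "e \<in> set cs" if e: "e \<in> F" "endpoint G (e, False) \<in> W" for e
  proof (rule ccontr)
    assume ecs: "e \<notin> set cs"
    \<comment> \<open>Fractional half-edges of \<open>W\<close> off \<open>cs\<close>. By
      \<open>on_us\<close> they avoid the vertices of \<open>cs\<close>, so the partner of each is
      again in \<open>H\<close>, and a circuit found in \<open>H\<close> is disjoint from
      \<open>cs\<close>.\<close>
    define H where "H = {h. fst h \<in> F - set cs \<and> endpoint G h \<in> W}"
    obtain vs ds where D: "circuit G vs ds" "set ds \<subseteq> fst ` H" "set vs \<subseteq> endpoint G ` H"
    proof (rule circuit_exists[of H "(e, False)"])
      show "finite H" by (rule finite_subset[of _ "F \<times> UNIV"]) (auto simp: H_def fF)
      show "(e, False) \<in> H" using e ecs by (simp add: H_def)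
      show "fst ` H \<subseteq> edges G" using FE by (auto simp: H_def)
      show "(e', \<not> b) \<in> H" if "(e', b) \<in> H" for e' b
        using that closed[of e' b] FE by (auto simp: H_def)
      show "\<exists>h'\<in>H. h' \<noteq> h \<and> endpoint G h' = endpoint G h" if h: "h \<in> H" for h
      proof -
        obtain h' where h': "h' \<noteq> h" "fst h' \<in> F" "endpoint G h' = endpoint G h"
          using another[of h] h by (auto simp: H_def half_edges_at_def)
        have "fst h' \<notin> set cs"
          using circuit_endpoint[OF C(1), of h'] on_us[of h] h h' by (auto simp: H_def)
        then show ?thesis using h h' by (intro bexI[of _ h']) (auto simp: H_def)
      qed
    qed blast
    have disj: "set us \<inter> set vs = {}" using D(3) on_us by (fastforce simp: H_def)
    have "set ds \<subseteq> F" using D(2) by (auto simp: H_def)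
    then have unb': "\<not> balanced \<sigma> ds"
      using circuit_unbalanced_if_independent[OF D(1), of F] ind by (simp add: F_def)
    obtain b where b: "b \<in> set vs" using D(1) by (cases vs) (auto simp: circuit_def)
    then have "b \<in> W" using D(3) by (auto simp: H_def)
    then obtain a where "a \<in> set us" "(a, b) \<in> R\<^sup>*" by (auto simp: W_def)
    then obtain ps qs where "path G ps qs" "set ps \<inter> set us = {hd ps}" "set ps \<inter> set vs = {last ps}"
      using joining_path[OF C(1) D(1) disj, of a b] b unfolding R_def by blast
    then have "long_barbell G \<sigma> us cs vs ds ps qs"
      using C(1) D(1) unb unb' disj by (simp add: long_barbell_def)
    then show False using nb by (auto simp: contains_long_barbell_def)
  qed
  \<comment> \<open>Now \<open>cs\<close> is the only fractional circuit in its component \<open>W\<close>, and comparing the sums over \<open>W\<close>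
    of the boundaries of \<open>x\<close> and \<open>f / k\<close> shows that \<open>cs\<close> is balanced.\<close>
  define EW where "EW = {e \<in> edges G. endpoint G (e, False) \<in> W}"
  \<comment> \<open>Zero on positive edges and 1 or -1 on negative ones, so its parity detects
    negative edges.\<close>
  define d where "d e = (\<tau> (e, False) + \<tau> (e, True)) div 2" for e
  have d: "\<tau> (e, False) + \<tau> (e, True) = 2 * d e" "odd (d e) \<longleftrightarrow> \<sigma> e = -1" if "e \<in> edges G" for e
    using tau_cases[OF that, of False] tau_cases[OF that, of True] tau_opposite[OF that, of False]
    by (auto simp: d_def)
  have fEW: "finite EW" using finite_edges by (simp add: EW_def)
  have csEW: "set cs \<subseteq> EW"
    using circuit_endpoint[OF C(1)] usW C(2) FE by (auto simp: EW_def)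
  have total: "(\<Sum>v\<in>W. bdr y v) = 2 * (\<Sum>e\<in>EW. d e * y e)" for y :: "'e \<Rightarrow> real"
  proof -
    have "(\<Sum>v\<in>W. bdr y v) = (\<Sum>e\<in>edges G. (\<Sum>v\<in>W. incidence v e) * y e)"
      unfolding bdr_def sum_distrib_right by (rule sum.swap)
    also have "\<dots> = (\<Sum>e\<in>edges G. if endpoint G (e, False) \<in> W then 2 * (d e * y e) else 0)"
    proof (intro sum.cong refl)
      fix e assume e: "e \<in> edges G"
      show "(\<Sum>v\<in>W. incidence v e) * y e
          = (if endpoint G (e, False) \<in> W then 2 * (d e * y e) else 0)"
        unfolding sum_incidence_closed[OF fW closed'[OF e]] d(1)[OF e] by simp
    qed
    also have "\<dots> = (\<Sum>e\<in>EW. 2 * (d e * y e))"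
      unfolding EW_def using finite_edges by (intro sum.inter_filter[symmetric])
    finally show ?thesis by (simp add: sum_distrib_left)
  qed
  have "(\<Sum>e\<in>EW. d e * x e) \<in> \<int>"
  proof -
    have "k dvd (\<Sum>v\<in>W. boundary G \<tau> f v)" using f W_verts by (intro dvd_sum) auto
    then obtain m where m: "(\<Sum>v\<in>W. boundary G \<tau> f v) = k * m" by blast
    have "real_of_int (k * m) = (\<Sum>v\<in>W. bdr (\<lambda>e. real_of_int (f e)) v)"
      by (simp add: m[symmetric] boundary_eq_bdr)
    also have "\<dots> = real_of_int (2 * (\<Sum>e\<in>EW. d e * f e))" by (simp add: total)
    finally have "k * m = 2 * (\<Sum>e\<in>EW. d e * f e)" by (simp only: of_int_eq_iff)
    \<comment> \<open>Here oddness of \<open>k\<close> is decisive: it passes evenness from the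
      total boundary of \<open>f\<close> over \<open>W\<close> to that of \<open>x\<close>, so
      halving the latter still gives an integer.\<close>
    then have "even (k * m)" by simp
    then have "even m" using \<open>odd k\<close> by simp
    then obtain j where j: "m = 2 * j" by blast
    have "real_of_int k * (\<Sum>v\<in>W. bdr x v) = (\<Sum>v\<in>W. real_of_int (boundary G \<tau> f v))"
      unfolding sum_distrib_left using bdr W_verts by (intro sum.cong) auto
    also have "\<dots> = real_of_int k * real_of_int m" by (metis m of_int_mult of_int_sum)
    finally have "(\<Sum>v\<in>W. bdr x v) = m" using k0 by simp
    then have "(\<Sum>e\<in>EW. d e * x e) = j" by (simp add: total j)
    then show ?thesis by simp
  qed
  moreover have "(\<Sum>e\<in>EW - set cs. d e * x e) \<in> \<int>"
  proof (rule Ints_sum)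
    fix e assume "e \<in> EW - set cs"
    then have "e \<notin> F" "e \<in> edges G" using only[of e] by (auto simp: EW_def)
    then have "x e = 0 \<or> x e = 1" by (auto simp: F_def fractional_def)
    then show "d e * x e \<in> \<int>" by auto
  qed
  moreover have "(\<Sum>e\<in>EW. d e * x e) = (\<Sum>e\<in>EW - set cs. d e * x e) + (\<Sum>e\<in>set cs. d e * x e)"
    using fEW csEW by (rule sum.subset_diff[rotated])
  ultimately have "(\<Sum>e\<in>set cs. d e * x e) \<in> \<int>" using Ints_diff by fastforce
  then obtain j where j: "(\<Sum>e\<in>set cs. d e * x e) = real_of_int j" by (auto elim: Ints_cases)
  \<comment> \<open>Since \<open>x\<close> is 1/2 on \<open>cs\<close>, integrality of this sum says
    that \<open>d\<close> has even sum over \<open>cs\<close>, that is, an even number of negative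
    edges.\<close>
  have "(\<Sum>e\<in>set cs. d e * x e) = (\<Sum>e\<in>set cs. real_of_int (d e) / 2)"
    using half C(2) by (intro sum.cong) auto
  then have "real_of_int (\<Sum>e\<in>set cs. d e) = real_of_int (2 * j)"
    using j by (simp add: sum_divide_distrib[symmetric])
  then have "even (\<Sum>e\<in>set cs. d e)" by (simp only: of_int_eq_iff) simp
  then have "even (card {e \<in> set cs. odd (d e)})" by (simp add: even_sum_iff)
  moreover have "{e \<in> set cs. odd (d e)} = {e \<in> set cs. \<sigma> e = -1}"
    using d(2) C(2) FE by auto
  ultimately show False using unb by (simp add: balanced_def)
qed

end

section \<open>Rounding the modular flow to an integer flow\<close>

theorem theorem3p5:
  fixes G :: "('v, 'e) multigraph" and \<sigma> :: "'e \<Rightarrow> int" and k :: int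
    and \<tau> :: "'e half_edge \<Rightarrow> int" and f\<^sub>1 :: "'e \<Rightarrow> int"
  assumes "k \<ge> 3" and "odd k"
    and "finite_graph G" and "signature G \<sigma>"
    and "nowhere_zero_mod_flow G \<sigma> k \<tau> f\<^sub>1"
    and "\<not> contains_long_barbell G \<sigma>"
  shows "\<exists>f\<^sub>2 :: 'e \<Rightarrow> int. nowhere_zero_flow G \<sigma> k \<tau> f\<^sub>2
           \<and> (\<forall>e\<in>edges G. [f\<^sub>1 e = f\<^sub>2 e] (mod k))"
proof -
  have ori: "orientation G \<sigma> \<tau>"
    and range: "\<And>e. e \<in> edges G \<Longrightarrow> 1 \<le> f\<^sub>1 e \<and> f\<^sub>1 e \<le> k - 1"
    and dvd: "\<And>v. v \<in> verts G \<Longrightarrow> k dvd boundary G \<tau> f\<^sub>1 v"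
    using assms(5) by (auto simp: nowhere_zero_mod_flow_def residue_ring_def cong_0_iff)
  interpret oriented_signed_graph G \<sigma> \<tau>
    using assms ori by unfold_locales
  define x\<^sub>0 where "x\<^sub>0 e = real_of_int (f\<^sub>1 e) / k" for e
  have x\<^sub>0: "0 \<le> x\<^sub>0 e \<and> x\<^sub>0 e \<le> 1" if "e \<in> edges G" for e
    using range[OF that] assms(1) by (simp add: x\<^sub>0_def)
  have bdr\<^sub>0: "real_of_int k * bdr x\<^sub>0 v = boundary G \<tau> f\<^sub>1 v" for v
    using assms(1) by (simp add: boundary_eq_bdr bdr_def x\<^sub>0_def sum_distrib_left)
  obtain x where x: "\<And>e. e \<in> edges G \<Longrightarrow> 0 \<le> x e \<and> x e \<le> 1"
    "\<And>v. v \<in> verts G \<Longrightarrow> bdr x v = bdr x\<^sub>0 v" "independent (fractional x)"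
    using independent_fractional_solution[of x\<^sub>0] x\<^sub>0 by blast
  have "fractional x = {}"
    using fractional_empty[OF assms(2) dvd assms(6) x(1) _ x(3)] x(2) bdr\<^sub>0 by simp
  then have x01: "x e = 0 \<or> x e = 1" if "e \<in> edges G" for e
    using that by (auto simp: fractional_def)
  \<comment> \<open>This is \<open>f\<^sub>1 - k x\<close> for the integral \<open>x\<close>.
    Subtracting \<open>k\<close> from a value in \<open>{1..k - 1}\<close> gives one between
    \<open>-(k - 1)\<close> and -1, so the bounds survive.\<close>
  define f\<^sub>2 where "f\<^sub>2 e = (if x e = 1 then f\<^sub>1 e - k else f\<^sub>1 e)" for e
  have "boundary G \<tau> f\<^sub>2 v = 0" if "v \<in> verts G" for v
  proof -
    have "real_of_int (boundary G \<tau> f\<^sub>2 v) = bdr (\<lambda>e. f\<^sub>1 e + (- real_of_int k) * x e) v"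
      unfolding boundary_eq_bdr bdr_def using x01 by (intro sum.cong refl) (auto simp: f\<^sub>2_def)
    also have "\<dots> = 0"
      unfolding bdr_add_scaled using x(2)[OF that] bdr\<^sub>0[of v] by (simp add: boundary_eq_bdr)
    finally show ?thesis by simp
  qed
  moreover have "1 \<le> \<bar>f\<^sub>2 e\<bar> \<and> \<bar>f\<^sub>2 e\<bar> \<le> k - 1" if "e \<in> edges G" for e
    using range[OF that] by (auto simp: f\<^sub>2_def)
  ultimately have "nowhere_zero_flow G \<sigma> k \<tau> f\<^sub>2" using ori by (auto simp: nowhere_zero_flow_def)
  moreover have "[f\<^sub>1 e = f\<^sub>2 e] (mod k)" for e by (simp add: f\<^sub>2_def cong_iff_dvd_diff)
  ultimately show ?thesis by blast
qed

end
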